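(* Let $\mathcal{M}$ be an NIP structure in a language $\mathcal{L}$, and assume that for every $\mathcal{L}$-formula $\varphi(x_1,x_2;z)$ with $|x_1|=|x_2|$ there is some $c=c(\varphi)$ such that $R^*_\varphi(n)\le n^c$ for all $n$ large enough. Then for every $k\ge3$ and every $\mathcal{L}$-formula $\varphi(x_1,\ldots,x_k;z)$ with $|x_1|=\cdots=|x_k|$ there is some $c=c(\varphi)$ such that $R^*_\varphi(n)\le\mathrm{twr}_{k-1}(n^c)$ for all $n$ large enough.
   Context: A family $\mathcal{F}$ of subsets of a set $X$ shatters $A\subseteq X$ if every subset of $A$ has the form $A\cap S$ with $S\in\mathcal{F}$; $\mathcal{F}$ is a VC-class if for some $n$ no subset of $X$ of size $n$ is shattered. A structure $\mathcal{M}$ with underlying set $M$ is NIP if for every formula $\theta(x,y)$ (with $x,y$ finite tuples of variables) the family $\{\theta(M,a):a\in M^{|y|}\}$ of subsets of $M^{|x|}$ is a VC-class. The tower function is defined by $\mathrm{twr}_1(n)=n$ and $\mathrm{twr}_{i+1}(n)=2^{\mathrm{twr}_i(n)}$. For a $k$-ary relation $E\subseteq X^k$ on a set $X$, a finite sequence $(a_i:1\le i\le m)$ in $X$ is $E$-indiscernible if either $E$ holds on all $k$-tuples $(a_{i_1},\ldots,a_{i_k})$ with $1\le i_1<\cdots<i_k\le m$, or $E$ fails on all such $k$-tuples. For a formula $\varphi(x_1,\ldots,x_k;z)$ with $|x_1|=\cdots=|x_k|=d$ and $b\in M^{|z|}$, let $R_{\varphi(x_1,\ldots,x_k;b)}(n)$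 be the smallest $N\in\mathbb{N}$ such that every sequence of length $N$ of elements of $M^d$ contains a subsequence of length $n$ that is indiscernible for the $k$-ary relation on $M^d$ defined by $\varphi(x_1,\ldots,x_k;b)$. Then $R^*_\varphi(n):=\max\{R_{\varphi(x_1,\ldots,x_k;b)}(n): b\in M^{|z|}\}$. *)

theory Defs
  imports "HOL-Library.Sublist" "HOL-Library.Ramsey"
begin

section \<open>First-order logic with equality\<close>

text \<open>The symbols form sets rather than whole types, so that either set may be empty. Constant
  symbols are function symbols of arity 0.\<close>

record ('f, 'r) fo_language =
  fun_syms :: "'f set"
  fun_arity :: "'f \<Rightarrow> nat"
  rel_syms :: "'r set"
  rel_arity :: "'r \<Rightarrow> nat"

datatype 'f fo_term = Var nat | App 'f "'f fo_term list"

datatype ('f, 'r) fo_form =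
    Eq "'f fo_term" "'f fo_term"
  | Rel 'r "'f fo_term list"
  | Neg "('f, 'r) fo_form"
  | Conj "('f, 'r) fo_form" "('f, 'r) fo_form"
  | Exi nat "('f, 'r) fo_form"

fun wf_term :: "('f, 'r) fo_language \<Rightarrow> 'f fo_term \<Rightarrow> bool" where
  "wf_term L (Var x) = True"
| "wf_term L (App f ts) =
    (f \<in> fun_syms L \<and> length ts = fun_arity L f \<and> (\<forall>t\<in>set ts. wf_term L t))"

fun wf_form :: "('f, 'r) fo_language \<Rightarrow> ('f, 'r) fo_form \<Rightarrow> bool" where
  "wf_form L (Eq s t) = (wf_term L s \<and> wf_term L t)"
| "wf_form L (Rel r ts) =
    (r \<in> rel_syms L \<and> length ts = rel_arity L r \<and> (\<forall>t\<in>set ts. wf_term L t))"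
| "wf_form L (Neg p) = wf_form L p"
| "wf_form L (Conj p q) = (wf_form L p \<and> wf_form L q)"
| "wf_form L (Exi x p) = wf_form L p"

fun term_vars :: "'f fo_term \<Rightarrow> nat set" where
  "term_vars (Var x) = {x}"
| "term_vars (App f ts) = (\<Union>t\<in>set ts. term_vars t)"

fun free_vars :: "('f, 'r) fo_form \<Rightarrow> nat set" where
  "free_vars (Eq s t) = term_vars s \<union> term_vars t"
| "free_vars (Rel r ts) = (\<Union>t\<in>set ts. term_vars t)"
| "free_vars (Neg p) = free_vars p"
| "free_vars (Conj p q) = free_vars p \<union> free_vars q"
| "free_vars (Exi x p) = free_vars p - {x}"

record ('f, 'r, 'm) fo_structure =
  univ :: "'m set"
  fun_interp :: "'f \<Rightarrow> 'm list \<Rightarrow> 'm"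
  rel_interp :: "'r \<Rightarrow> 'm list \<Rightarrow> bool"

definition tuples :: "'m set \<Rightarrow> nat \<Rightarrow> 'm list set" where
  "tuples A d = {as. set as \<subseteq> A \<and> length as = d}"

definition is_structure ::
  "('f, 'r) fo_language \<Rightarrow> ('f, 'r, 'm) fo_structure \<Rightarrow> bool" where
  "is_structure L M \<longleftrightarrow> univ M \<noteq> {} \<and>
    (\<forall>f\<in>fun_syms L. \<forall>as\<in>tuples (univ M) (fun_arity L f). fun_interp M f as \<in> univ M)"

fun term_val :: "('f, 'r, 'm) fo_structure \<Rightarrow> (nat \<Rightarrow> 'm) \<Rightarrow> 'f fo_term \<Rightarrow> 'm" where
  "term_val M v (Var x) = v x"
| "term_val M v (App f ts) = fun_interp M f (map (term_val M v) ts)"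

fun sat :: "('f, 'r, 'm) fo_structure \<Rightarrow> (nat \<Rightarrow> 'm) \<Rightarrow> ('f, 'r) fo_form \<Rightarrow> bool" where
  "sat M v (Eq s t) = (term_val M v s = term_val M v t)"
| "sat M v (Rel r ts) = rel_interp M r (map (term_val M v) ts)"
| "sat M v (Neg p) = (\<not> sat M v p)"
| "sat M v (Conj p q) = (sat M v p \<and> sat M v q)"
| "sat M v (Exi x p) = (\<exists>a\<in>univ M. sat M (v(x := a)) p)"

text \<open>\<open>formula_in L vs p\<close>: \<open>p(vs)\<close> is an \<open>L\<close>-formula whose free variables are among the distinct
  variables \<open>vs\<close>.\<close>

definition formula_in :: "('f, 'r) fo_language \<Rightarrow> nat list \<Rightarrow> ('f, 'r) fo_form \<Rightarrow> bool" where
  "formula_in L vs p \<longleftrightarrow> wf_form L p \<and> distinct vs \<and> free_vars p \<subseteq> set vs"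

text \<open>\<open>holds M p vs as\<close>: \<open>M \<Turnstile> p(as)\<close>, where \<open>as\<close> is substituted for the variables \<open>vs\<close>. The values of
  variables outside \<open>vs\<close> are junk; they are irrelevant when \<open>formula_in L vs p\<close>.\<close>

definition holds ::
  "('f, 'r, 'm) fo_structure \<Rightarrow> ('f, 'r) fo_form \<Rightarrow> nat list \<Rightarrow> 'm list \<Rightarrow> bool" where
  "holds M p vs as \<longleftrightarrow> sat M (\<lambda>x. the (map_of (zip vs as) x)) p"


section \<open>VC-classes and NIP\<close>

definition shatters :: "'a set set \<Rightarrow> 'a set \<Rightarrow> bool" where
  "shatters F A \<longleftrightarrow> (\<forall>B. B \<subseteq> A \<longrightarrow> (\<exists>S\<in>F. B = A \<inter> S))"

definition VC_class :: "'a set \<Rightarrow> 'a set set \<Rightarrow> bool" where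
  "VC_class X F \<longleftrightarrow> (\<exists>n. \<not> (\<exists>A. A \<subseteq> X \<and> finite A \<and> card A = n \<and> shatters F A))"

definition NIP :: "('f, 'r) fo_language \<Rightarrow> ('f, 'r, 'm) fo_structure \<Rightarrow> bool" where
  "NIP L M \<longleftrightarrow> (\<forall>p xs ys. formula_in L (xs @ ys) p \<longrightarrow>
    VC_class (tuples (univ M) (length xs))
      ((\<lambda>b. {a \<in> tuples (univ M) (length xs). holds M p (xs @ ys) (a @ b)})
         ` tuples (univ M) (length ys)))"


section \<open>Ramsey growth\<close>

text \<open>The value at index 0 is junk: indexing starts at 1.\<close>

fun twr :: "nat \<Rightarrow> nat \<Rightarrow> nat" where
  "twr 0 n = 0"
| "twr (Suc 0) n = n"
| "twr (Suc (Suc i)) n = 2 ^ twr (Suc i) n"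

text \<open>A \<open>k\<close>-ary relation on \<open>'a\<close> is a predicate on lists, relevant only on lists of length \<open>k\<close>.\<close>

definition increasing_indices :: "nat \<Rightarrow> nat \<Rightarrow> nat list set" where
  "increasing_indices k m = {is. length is = k \<and> sorted_wrt (<) is \<and> set is \<subseteq> {..<m}}"

definition indiscernible :: "nat \<Rightarrow> ('a list \<Rightarrow> bool) \<Rightarrow> 'a list \<Rightarrow> bool" where
  "indiscernible k E s \<longleftrightarrow>
    (\<forall>is\<in>increasing_indices k (length s). E (map ((!) s) is)) \<or>
    (\<forall>is\<in>increasing_indices k (length s). \<not> E (map ((!) s) is))"

definition ramsey_prop :: "'a set \<Rightarrow> nat \<Rightarrow> ('a list \<Rightarrow> bool) \<Rightarrow> nat \<Rightarrow> nat \<Rightarrow> bool" where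
  "ramsey_prop X k E n N \<longleftrightarrow>
    (\<forall>s. set s \<subseteq> X \<and> length s = N \<longrightarrow>
      (\<exists>t. subseq t s \<and> length t = n \<and> indiscernible k E t))"

definition ramsey_number :: "'a set \<Rightarrow> nat \<Rightarrow> ('a list \<Rightarrow> bool) \<Rightarrow> nat \<Rightarrow> nat" where
  "ramsey_number X k E n = (LEAST N. ramsey_prop X k E n N)"

text \<open>By Ramsey's theorem the minimum defining \<open>ramsey_number\<close> exists, and it is bounded
  independently of the relation, so the maximum defining \<open>R_star\<close> exists as well.\<close>

lemma ex_ramsey_prop: "\<exists>N. \<forall>X (E :: 'a list \<Rightarrow> bool). ramsey_prop X k E n N"
proof -
  obtain N :: nat where N: "partn_lst {..<N} [n, n] k"
    using ramsey_full by blast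
  have "\<exists>t. subseq t s \<and> length t = n \<and> indiscernible k E t"
    if len: "length s = N" for s :: "'a list" and E
  proof -
    define f :: "nat set \<Rightarrow> nat" where
      "f S = (if E (map ((!) s) (sorted_list_of_set S)) then 0 else 1)" for S
    have "f \<in> nsets {..<N} k \<rightarrow> {..<2}"
      by (auto simp: f_def)
    then obtain i H where i: "i < 2" and H: "H \<in> nsets {..<N} ([n, n] ! i)"
      and fH: "f ` nsets H k \<subseteq> {i}"
      using partn_lstE[OF N, of f 2] by (metis length_Cons list.size(3) numeral_2_eq_2)
    from i have "[n, n] ! i = n"
      by (auto simp: less_2_cases_iff)
    with H have HN: "H \<subseteq> {..<N}" "finite H" "card H = n"
      by (auto simp: nsets_def)
    define l where "l = sorted_list_of_set H"
    have l: "sorted_wrt (<) l" "set l = H" "length l = n"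
      using HN by (auto simp: l_def)
    have "l = filter (\<lambda>j. j \<in> H) [0..<N]"
      using l HN by (intro strict_sorted_equal) (auto simp: strict_sorted_iff intro!: sorted_filter[of id, simplified])
    then have "subseq l [0..<N]"
      by (metis subseq_filter_left)
    then have sub: "subseq (map ((!) s) l) s"
      using subseq_map[of l "[0..<N]" "(!) s"] len map_nth[of s] by simp
    have key: "E (map ((!) (map ((!) s) l)) is) \<longleftrightarrow> i = 0"
      if "is \<in> increasing_indices k n" for "is"
    proof -
      have I: "length is = k" "sorted_wrt (<) is" "set is \<subseteq> {..<n}"
        using that by (auto simp: increasing_indices_def)
      let ?J = "map ((!) l) is"
      have "sorted_wrt (<) ?J"
        using I l by (auto simp: sorted_wrt_iff_nth_less subset_iff in_set_conv_nth)
      then have J: "sorted_list_of_set (set ?J) = ?J" "distinct ?J"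
        unfolding strict_sorted_iff
        by (blast intro: sorted_list_of_set.idem_if_sorted_distinct)+
      have "set ?J \<subseteq> H"
        using I l by (force simp: in_set_conv_nth)
      moreover have "card (set ?J) = k"
        using distinct_card[OF J(2)] I by simp
      ultimately have "set ?J \<in> nsets H k"
        by (simp add: nsets_def)
      with fH have "f (set ?J) = i"
        by blast
      moreover have "map ((!) (map ((!) s) l)) is = map ((!) s) ?J"
        using I l by auto
      ultimately show ?thesis
        using i unfolding f_def J(1) by (metis zero_neq_one)
    qed
    have "indiscernible k E (map ((!) s) l)"
      using key l by (auto simp: indiscernible_def)
    with sub l show ?thesis
      by (metis length_map)
  qed
  then show ?thesis
    unfolding ramsey_prop_def by blast
qed

lemma ramsey_prop_ramsey_number: "ramsey_prop X k E n (ramsey_number X k E n)"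
  unfolding ramsey_number_def using ex_ramsey_prop by (metis LeastI)

text \<open>\<open>k_formula L k d xss zs p\<close>: \<open>p(x\<^sub>1, \<dots>, x\<^sub>k; z)\<close> is an \<open>L\<close>-formula with \<open>xss = [x\<^sub>1, \<dots>, x\<^sub>k]\<close>,
  \<open>zs = z\<close> and all \<open>x\<^sub>i\<close> of length \<open>d\<close>.\<close>

definition k_formula ::
  "('f, 'r) fo_language \<Rightarrow> nat \<Rightarrow> nat \<Rightarrow> nat list list \<Rightarrow> nat list \<Rightarrow> ('f, 'r) fo_form \<Rightarrow> bool" where
  "k_formula L k d xss zs p \<longleftrightarrow>
    length xss = k \<and> (\<forall>xs\<in>set xss. length xs = d) \<and> formula_in L (concat xss @ zs) p"

definition defined_rel ::
  "('f, 'r, 'm) fo_structure \<Rightarrow> nat list list \<Rightarrow> nat list \<Rightarrow> ('f, 'r) fo_form \<Rightarrow> 'm list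
    \<Rightarrow> 'm list list \<Rightarrow> bool" where
  "defined_rel M xss zs p b as \<longleftrightarrow> holds M p (concat xss @ zs) (concat as @ b)"

definition R_form ::
  "('f, 'r, 'm) fo_structure \<Rightarrow> nat \<Rightarrow> nat \<Rightarrow> nat list list \<Rightarrow> nat list \<Rightarrow> ('f, 'r) fo_form
    \<Rightarrow> 'm list \<Rightarrow> nat \<Rightarrow> nat" where
  "R_form M k d xss zs p b n =
    ramsey_number (tuples (univ M) d) k (defined_rel M xss zs p b) n"

definition R_star ::
  "('f, 'r, 'm) fo_structure \<Rightarrow> nat \<Rightarrow> nat \<Rightarrow> nat list list \<Rightarrow> nat list \<Rightarrow> ('f, 'r) fo_form
    \<Rightarrow> nat \<Rightarrow> nat" where
  "R_star M k d xss zs p n =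
    Max ((\<lambda>b. R_form M k d xss zs p b n) ` tuples (univ M) (length zs))"

lemma finite_R_form:
  fixes M :: "('f, 'r, 'm) fo_structure"
  shows "finite ((\<lambda>b. R_form M k d xss zs p b n) ` B)"
proof -
  obtain N where "\<forall>X (E :: 'm list list \<Rightarrow> bool). ramsey_prop X k E n N"
    using ex_ramsey_prop by blast
  then have "(\<lambda>b. R_form M k d xss zs p b n) ` B \<subseteq> {..N}"
    by (auto simp: R_form_def ramsey_number_def intro: Least_le)
  then show ?thesis
    by (rule finite_subset) simp
qed

lemma R_star_attained:
  assumes "is_structure L M"
  shows "\<exists>b\<in>tuples (univ M) (length zs). R_star M k d xss zs p n = R_form M k d xss zs p b n"
proof -
  obtain a where "a \<in> univ M"
    using assms by (auto simp: is_structure_def)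
  then have "replicate (length zs) a \<in> tuples (univ M) (length zs)"
    by (auto simp: tuples_def)
  then have "R_star M k d xss zs p n
      \<in> (\<lambda>b. R_form M k d xss zs p b n) ` tuples (univ M) (length zs)"
    unfolding R_star_def by (intro Max_in finite_R_form) auto
  then show ?thesis
    by auto
qed

end

theory Submission
  imports Defs
begin

text \<open>The bound comes from the Erdos--Rado stepping-up argument, with the observation that it stays
  inside the definable relations. Call a sequence end-homogeneous for a \<open>(k+1)\<close>-ary relation \<open>E\<close> if
  \<open>E(x\<^sub>1, \<dots>, x\<^sub>k, y)\<close> does not depend on the choice of \<open>y\<close> among the later terms. Choosing terms
  greedily, and splitting the remaining sequence at each step according to how its terms relate to
  the terms already chosen, every sequence of length \<open>2 ^ (m ^ (k+1))\<close> with \<open>k \<ge> 1\<close> contains an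
  end-homogeneous subsequence of length \<open>m\<close> (\<open>long_list_has_end_homogeneous_subseq\<close>).

  On an end-homogeneous sequence with last term \<open>y\<close>, the relation \<open>E\<close> is governed by the \<open>k\<close>-ary
  relation \<open>E(x\<^sub>1, \<dots>, x\<^sub>k, y)\<close>. If \<open>E\<close> is defined by \<open>\<phi>(x\<^sub>1, \<dots>, x\<^sub>k, x\<^sub>k\<^sub>+\<^sub>1; b)\<close>, this relation is
  defined by the same formula with the variables grouped as \<open>\<phi>(x\<^sub>1, \<dots>, x\<^sub>k; x\<^sub>k\<^sub>+\<^sub>1 z)\<close> and the parameter
  \<open>yb\<close>. As \<open>R\<^sup>*\<close> is uniform in the parameters, the Ramsey function of the new grouping bounds that of
  the old one: \<open>R\<^sup>*\<^sub>k\<^sub>+\<^sub>1(n) \<le> 2 ^ ((R\<^sup>*\<^sub>k(n) + 1) ^ (k+1))\<close> (\<open>R_star_step\<close>).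

  Induction on \<open>k\<close>, starting from the polynomial bound for \<open>k = 2\<close>, adds one exponential at each step;
  the power \<open>k + 1\<close> in the exponent is absorbed into the exponent \<open>c\<close> at the bottom of the tower
  (\<open>twr_absorbs_power\<close>).\<close>

section \<open>End-homogeneous subsequences\<close>

lemma subseq_set_subset: "subseq xs ys \<Longrightarrow> set xs \<subseteq> set ys"
  by (induction rule: list_emb.induct) auto

lemma list_pigeonhole:
  assumes "finite C" and "f ` set s \<subseteq> C" and "card C * q < length s"
  shows "\<exists>c. q < length (filter (\<lambda>y. f y = c) s)"
proof (rule ccontr)
  assume "\<not> ?thesis"
  then have "count_list (map f s) c \<le> q" for c
    by (simp add: count_list_eq_length_filter filter_map comp_def not_less eq_commute[of c])
  then have "(\<Sum>c\<in>C. count_list (map f s) c) \<le> card C * q"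
    using sum_bounded_above[of C "count_list (map f s)" q] by simp
  moreover have "(\<Sum>c\<in>C. count_list (map f s) c) = length (map f s)"
    using assms by (intro sum_count_set) auto
  ultimately show False
    using assms(3) by simp
qed

text \<open>The set \<open>A\<close> stands for terms preceding \<open>t\<close>. Admitting arbitrary lists \<open>c\<close> over the earlier terms,
  rather than only increasing ones, removes the order from the count of tuples.\<close>

definition end_homogeneous :: "nat \<Rightarrow> ('a list \<Rightarrow> bool) \<Rightarrow> 'a set \<Rightarrow> 'a list \<Rightarrow> bool" where
  "end_homogeneous k E A t \<longleftrightarrow>
    (\<forall>u v c. t = u @ v \<longrightarrow> set c \<subseteq> A \<union> set u \<longrightarrow> length c = k \<longrightarrow>
      (\<forall>y\<in>set v. \<forall>y'\<in>set v. E (c @ [y]) = E (c @ [y'])))"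

lemma end_homogeneousD:
  assumes "end_homogeneous k E A (u @ v)" "set c \<subseteq> A \<union> set u" "length c = k"
    and "y \<in> set v" "y' \<in> set v"
  shows "E (c @ [y]) = E (c @ [y'])"
  using assms unfolding end_homogeneous_def by blast

lemma end_homogeneous_Cons:
  assumes "\<forall>c. set c \<subseteq> A \<longrightarrow> length c = k \<longrightarrow>
      (\<forall>y\<in>set (x # t). \<forall>y'\<in>set (x # t). E (c @ [y]) = E (c @ [y']))"
    and "end_homogeneous k E (insert x A) t"
  shows "end_homogeneous k E A (x # t)"
  unfolding end_homogeneous_def
proof (intro allI impI)
  fix u v c
  assume uv: "x # t = u @ v" and c: "set c \<subseteq> A \<union> set u" "length c = k"
  show "\<forall>y\<in>set v. \<forall>y'\<in>set v. E (c @ [y]) = E (c @ [y'])"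
  proof (cases u)
    case Nil
    then have "v = x # t" "set c \<subseteq> A" using uv c by simp_all
    then show ?thesis using assms(1) c(2) by blast
  next
    case (Cons x' u')
    then have "t = u' @ v" "set c \<subseteq> insert x A \<union> set u'" using uv c by auto
    then show ?thesis
      using end_homogeneousD[of k E "insert x A" u' v c] assms(2) c(2) by blast
  qed
qed

text \<open>The set \<open>A\<close> collects the terms chosen so far and \<open>s\<close> the terms still available; tuples over \<open>A\<close>
  do not distinguish the latter. After a further term is moved to \<open>A\<close>, the rest of \<open>s\<close> is classified
  by the set of tuples over the new \<open>A\<close> with which a term satisfies \<open>E\<close>. There are at most \<open>m ^ k\<close>
  tuples, hence at most \<open>2 ^ (m ^ k)\<close> classes, and some class is long enough to continue.\<close>

lemma greedy_end_homogeneous_subseq: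
  fixes E :: "'a list \<Rightarrow> bool"
  assumes "finite A" and "card A + j \<le> m" and "(2 ^ (m ^ k)) ^ j \<le> length s"
    and "\<forall>c. set c \<subseteq> A \<longrightarrow> length c = k \<longrightarrow>
      (\<forall>y\<in>set s. \<forall>y'\<in>set s. E (c @ [y]) = E (c @ [y']))"
  shows "\<exists>t. subseq t s \<and> length t = j \<and> end_homogeneous k E A t"
  using assms
proof (induction j arbitrary: A s)
  case 0
  show ?case
    by (intro exI[of _ "[]"]) (auto simp: end_homogeneous_def)
next
  case (Suc j)
  define D :: nat where "D = 2 ^ (m ^ k)"
  have m: "m \<noteq> 0" using Suc.prems(2) by simp
  have D: "D \<ge> 2"
    using self_le_power[of "2::nat" "m ^ k"] m by (simp add: D_def)
  have len: "D * D ^ j \<le> length s"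
    using Suc.prems(3) by (simp add: D_def)
  moreover have "D * D ^ j > 0" using D by simp
  ultimately obtain x s' where s: "s = x # s'"
    by (cases s) auto
  define A' where "A' = insert x A"
  define C where "C = {c. set c \<subseteq> A' \<and> length c = k}"
  define f where "f y = {c \<in> C. E (c @ [y])}" for y
  have A': "finite A'" "card A' \<le> Suc (card A)"
    using Suc.prems(1) by (auto simp: A'_def card_insert_if)
  then have "card A' \<le> m" using Suc.prems(2) by simp
  then have cardC: "finite C" "card C \<le> m ^ k"
    using A'(1) by (auto simp: C_def card_lists_length_eq finite_lists_length_eq power_mono)
  then have "card (Pow C) \<le> D"
    by (simp add: card_Pow D_def power_increasing)
  then have "card (Pow C) * (D ^ j - 1) \<le> D * (D ^ j - 1)"
    by (rule mult_le_mono1)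
  \<comment> \<open>Discarding \<open>x\<close> costs one term; the gap \<open>D \<ge> 2\<close> between \<open>D * (D ^ j - 1)\<close> and \<open>D ^ (j + 1)\<close>
      pays for it.\<close>
  also have "\<dots> < length s'"
  proof -
    have "D * (D ^ j - 1) + D = D * D ^ j" using D by (cases "D ^ j") auto
    then show ?thesis using len D s by simp
  qed
  finally obtain c where c: "D ^ j - 1 < length (filter (\<lambda>y. f y = c) s')"
    using list_pigeonhole[of "Pow C" f s' "D ^ j - 1"] cardC(1) by (auto simp: f_def)
  define s'' where "s'' = filter (\<lambda>y. f y = c) s'"
  have hom: "\<forall>b. set b \<subseteq> A' \<longrightarrow> length b = k \<longrightarrow>
      (\<forall>y\<in>set s''. \<forall>y'\<in>set s''. E (b @ [y]) = E (b @ [y']))"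
  proof (intro allI impI ballI)
    fix b y y' assume "set b \<subseteq> A'" "length b = k" "y \<in> set s''" "y' \<in> set s''"
    then have "f y = f y'" "b \<in> C" by (auto simp: s''_def C_def)
    then show "E (b @ [y]) = E (b @ [y'])" unfolding f_def by blast
  qed
  have "card A' + j \<le> m" using A'(2) Suc.prems(2) by simp
  moreover have "(2 ^ (m ^ k)) ^ j \<le> length s''"
    using c unfolding s''_def D_def by linarith
  ultimately have "\<exists>t. subseq t s'' \<and> length t = j \<and> end_homogeneous k E A' t"
    using Suc.IH[OF A'(1) _ _ hom] by blast
  then obtain t where t: "subseq t s''" "length t = j" "end_homogeneous k E A' t"
    by blast
  have "subseq t s'"
    using t(1) subseq_order.trans[of t s'' s'] by (simp add: s''_def)
  then have sub: "subseq (x # t) s" by (simp add: s)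
  then have "set (x # t) \<subseteq> set s" by (rule subseq_set_subset)
  then have "end_homogeneous k E A (x # t)"
    using Suc.prems(4) t(3)[unfolded A'_def] by (intro end_homogeneous_Cons) blast+
  with sub t(2) show ?case
    by (intro exI[of _ "x # t"]) simp
qed

text \<open>The assumption \<open>k > 0\<close> makes the empty starting set harmless: for \<open>k = 0\<close> the value \<open>E [y]\<close> would
  already have to be constant before the first term is chosen.\<close>

lemma long_list_has_end_homogeneous_subseq:
  assumes "k > 0" and "2 ^ (m ^ Suc k) \<le> length s"
  shows "\<exists>t. subseq t s \<and> length t = m \<and> end_homogeneous k E {} t"
proof (rule greedy_end_homogeneous_subseq)
  show "(2 ^ (m ^ k)) ^ m \<le> length s"
    using assms(2) unfolding power_mult[symmetric] power_Suc2 .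
qed (use assms(1) in auto)

section \<open>The stepping-up inequality\<close>

text \<open>A \<open>(k+1)\<close>-tuple from \<open>u\<close> may have its last entry replaced by \<open>y\<close>, because both come after its
  first \<open>k\<close> entries in the end-homogeneous sequence. The set-based form of end-homogeneity needs a cut
  of \<open>t\<close> between the first \<open>k\<close> entries and the last one; it is obtained by cutting the embedding of
  \<open>u\<close> into \<open>t\<close>.\<close>

lemma indiscernible_step_up:
  assumes hom: "end_homogeneous k E {} (t @ [y])"
    and sub: "subseq u t"
    and ind: "indiscernible k (\<lambda>as. E (as @ [y])) u"
  shows "indiscernible (Suc k) E u"
proof -
  have key: "\<exists>is'\<in>increasing_indices k (length u). E (map ((!) u) is) = E (map ((!) u) is' @ [y])"
    if "is \<in> increasing_indices (Suc k) (length u)" for "is"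
  proof -
    have I: "length is = Suc k" "sorted_wrt (<) is" "set is \<subseteq> {..<length u}"
      using that by (auto simp: increasing_indices_def)
    then obtain is' i where is': "is = is' @ [i]"
      by (metis length_Suc_conv_rev)
    have i: "i < length u" "\<forall>j\<in>set is'. j < i"
      using I is' by (auto simp: sorted_wrt_append)
    have "subseq (take i u @ u ! i # drop (Suc i) u) t"
      using sub i(1) by (simp add: id_take_nth_drop[symmetric])
    then obtain t1 t2 where t: "t = t1 @ t2"
        "subseq (take i u) t1" "subseq (u ! i # drop (Suc i) u) t2"
      by (blast dest: list_emb_appendD)
    have "set (map ((!) u) is') \<subseteq> set (take i u)"
      using i by (force simp: in_set_conv_nth)
    also have "\<dots> \<subseteq> set t1"
      using t(2) by (rule subseq_set_subset)
    finally have "E (map ((!) u) is' @ [u ! i]) = E (map ((!) u) is' @ [y])"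
      using hom subseq_set_subset[OF t(3)] I is'
      by (intro end_homogeneousD[of k E "{}" t1 "t2 @ [y]"]) (auto simp: t(1))
    moreover have "is' \<in> increasing_indices k (length u)"
      using I is' by (auto simp: increasing_indices_def sorted_wrt_append)
    ultimately show ?thesis
      by (intro bexI[of _ is']) (simp_all add: is')
  qed
  then show ?thesis
    using ind unfolding indiscernible_def by metis
qed

lemma ramsey_prop_mono:
  assumes "ramsey_prop X k E n N" and "N \<le> N'"
  shows "ramsey_prop X k E n N'"
  unfolding ramsey_prop_def
proof (intro allI impI)
  fix s assume s: "set s \<subseteq> X \<and> length s = N'"
  then have "set (take N s) \<subseteq> X" "length (take N s) = N"
    using assms(2) set_take_subset[of N s] by auto
  then obtain t where "subseq t (take N s)" "length t = n" "indiscernible k E t"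
    using assms(1) unfolding ramsey_prop_def by blast
  moreover have "subseq (take N s) s"
    by (simp add: prefix_imp_subseq take_is_prefix)
  ultimately show "\<exists>t. subseq t s \<and> length t = n \<and> indiscernible k E t"
    using subseq_order.trans by blast
qed

text \<open>The end-homogeneous sequence has length \<open>N + 1\<close>: its last term serves as the fixed entry \<open>y\<close>, and
  the hypothesis is applied to the \<open>N\<close> terms before it.\<close>

lemma ramsey_prop_step_up:
  assumes "k > 0" and ram: "\<And>y. y \<in> X \<Longrightarrow> ramsey_prop X k (\<lambda>as. E (as @ [y])) n N"
  shows "ramsey_prop X (Suc k) E n (2 ^ ((N + 1) ^ Suc k))"
  unfolding ramsey_prop_def
proof (intro allI impI)
  fix s assume s: "set s \<subseteq> X \<and> length s = 2 ^ ((N + 1) ^ Suc k)"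
  then obtain t' where t': "subseq t' s" "length t' = N + 1" "end_homogeneous k E {} t'"
    using long_list_has_end_homogeneous_subseq[OF assms(1), of "N + 1" s E] by auto
  then obtain t y where t: "t' = t @ [y]" "length t = N"
    by (metis Suc_eq_plus1 length_Suc_conv_rev)
  have "set t' \<subseteq> X"
    using subseq_set_subset[OF t'(1)] s by blast
  then have "y \<in> X" "set t \<subseteq> X" using t by auto
  then obtain u where u: "subseq u t" "length u = n" "indiscernible k (\<lambda>as. E (as @ [y])) u"
    using ram[of y] t(2) unfolding ramsey_prop_def by blast
  have "indiscernible (Suc k) E u"
    using t'(3) u unfolding t(1) by (intro indiscernible_step_up)
  moreover have "subseq u s"
    using subseq_rev_drop_many[OF u(1), of "[y]"] t'(1) t(1) subseq_order.trans by blast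
  ultimately show "\<exists>u. subseq u s \<and> length u = n \<and> indiscernible (Suc k) E u"
    using u(2) by blast
qed

text \<open>Regrouping the variables as \<open>\<phi>(x\<^sub>1, \<dots>, x\<^sub>k; x\<^sub>k\<^sub>+\<^sub>1 z)\<close> turns the last entry into a parameter without
  changing the formula.\<close>

lemma k_formula_regroup:
  assumes "k_formula L (Suc k) d (xss @ [xs]) zs p"
  shows "k_formula L k d xss (xs @ zs) p"
  using assms by (simp add: k_formula_def)

lemma R_star_step:
  assumes M: "is_structure L M" and "k > 0" and xs: "length xs = d"
  shows "R_star M (Suc k) d (xss @ [xs]) zs p n
    \<le> 2 ^ ((R_star M k d xss (xs @ zs) p n + 1) ^ Suc k)"
proof -
  let ?X = "tuples (univ M) d"
  let ?N = "R_star M k d xss (xs @ zs) p n"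
  obtain b where b: "b \<in> tuples (univ M) (length zs)"
    and R: "R_star M (Suc k) d (xss @ [xs]) zs p n = R_form M (Suc k) d (xss @ [xs]) zs p b n"
    using R_star_attained[OF M] by blast
  have "ramsey_prop ?X k (\<lambda>as. defined_rel M (xss @ [xs]) zs p b (as @ [y])) n ?N"
    if y: "y \<in> ?X" for y
  proof -
    have "y @ b \<in> tuples (univ M) (length (xs @ zs))"
      using y b xs by (auto simp: tuples_def)
    then have "R_form M k d xss (xs @ zs) p (y @ b) n \<le> ?N"
      unfolding R_star_def by (intro Max_ge finite_R_form imageI)
    then have "ramsey_prop ?X k (defined_rel M xss (xs @ zs) p (y @ b)) n ?N"
      unfolding R_form_def by (rule ramsey_prop_mono[OF ramsey_prop_ramsey_number])
    moreover have "defined_rel M xss (xs @ zs) p (y @ b)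
        = (\<lambda>as. defined_rel M (xss @ [xs]) zs p b (as @ [y]))"
      by (simp add: defined_rel_def fun_eq_iff)
    ultimately show ?thesis by simp
  qed
  then show ?thesis
    unfolding R R_form_def ramsey_number_def
    by (intro Least_le ramsey_prop_step_up \<open>k > 0\<close>)
qed

section \<open>Tower growth\<close>

lemma twr_pos: "0 < i \<Longrightarrow> 0 < x \<Longrightarrow> 0 < twr i x"
  by (induction i x rule: twr.induct) auto

lemma twr_Suc: "0 < i \<Longrightarrow> twr (Suc i) x = 2 ^ twr i x"
  by (cases i) auto

text \<open>Raising a tower \<open>2 ^ t\<close> to a power multiplies \<open>t\<close> by a constant, and a constant factor is in turn
  at most a power of \<open>t + 1\<close>; repeating this pushes the power down to the bottom of the tower. There the restriction to
  \<open>n \<ge> 2\<close> lets a factor \<open>n\<close> absorb the summand \<open>1\<close>.\<close>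

lemma twr_absorbs_power:
  assumes "0 < i"
  shows "\<exists>c'. \<forall>n\<ge>2. (twr i (n ^ c) + 1) ^ l \<le> twr i (n ^ c')"
  using assms
proof (induction i arbitrary: l rule: nat_induct_non_zero)
  case 1
  have "(n ^ c + 1) ^ l \<le> n ^ (Suc c * l)" if "n \<ge> 2" for n :: nat
  proof -
    have "n ^ c + 1 \<le> 2 * n ^ c" using that by (simp add: Suc_le_eq)
    also have "\<dots> \<le> n ^ Suc c" using that by simp
    finally show ?thesis
      unfolding power_mult by (rule power_mono) simp
  qed
  then show ?case
    by (intro exI[of _ "Suc c * l"]) simp
next
  case (Suc i)
  obtain c' where c': "\<forall>n\<ge>2. (twr i (n ^ c) + 1) ^ Suc l \<le> twr i (n ^ c')"
    using Suc.IH by blast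
  have "(twr (Suc i) (n ^ c) + 1) ^ l \<le> twr (Suc i) (n ^ c')" if n: "n \<ge> 2" for n
  proof -
    define t where "t = twr i (n ^ c)"
    have "t > 0" using n Suc.hyps by (simp add: t_def twr_pos)
    have "((2::nat) ^ t + 1) ^ l \<le> (2 ^ (t + 1)) ^ l"
      by (intro power_mono) simp_all
    also have "\<dots> = 2 ^ ((t + 1) * l)" by (simp only: power_mult)
    also have "\<dots> \<le> 2 ^ ((t + 1) ^ Suc l)"
    proof -
      have "l \<le> 2 ^ l" by (simp add: less_imp_le)
      also have "\<dots> \<le> (t + 1) ^ l" using \<open>t > 0\<close> by (intro power_mono) simp_all
      finally have "(t + 1) * l \<le> (t + 1) ^ Suc l"
        unfolding power_Suc by (rule mult_le_mono2)
      then show ?thesis by (intro power_increasing) simp_all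
    qed
    also have "\<dots> \<le> 2 ^ twr i (n ^ c')"
      using c' n unfolding t_def by (intro power_increasing) simp_all
    finally show ?thesis
      using Suc.hyps by (simp add: twr_Suc t_def)
  qed
  then show ?case by blast
qed

section \<open>The tower bound\<close>

theorem theorem1p17:
  fixes L :: "('f, 'r) fo_language" and M :: "('f, 'r, 'm) fo_structure"
  assumes "is_structure L M"
    and "NIP L M"
    and "\<And>d xss zs p. k_formula L 2 d xss zs p \<Longrightarrow>
           \<exists>c::nat. \<forall>\<^sub>F n in sequentially. R_star M 2 d xss zs p n \<le> n ^ c"
  shows "\<forall>k\<ge>3. \<forall>d xss zs p. k_formula L k d xss zs p \<longrightarrow>
           (\<exists>c::nat. \<forall>\<^sub>F n in sequentially. R_star M k d xss zs p n \<le> twr (k - 1) (n ^ c))"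
proof -
  have "\<exists>c. \<forall>\<^sub>F n in sequentially. R_star M k d xss zs p n \<le> twr (k - 1) (n ^ c)"
    if "k \<ge> 2" "k_formula L k d xss zs p" for k d xss zs p
    using that
  proof (induction k arbitrary: xss zs rule: nat_induct_at_least)
    case base
    then show ?case using assms(3) by simp
  next
    case (Suc k)
    obtain yss ys where xss: "xss = yss @ [ys]"
      using Suc.prems by (auto simp: k_formula_def length_Suc_conv_rev)
    have ys: "length ys = d" using Suc.prems by (simp add: k_formula_def xss)
    obtain c where c: "\<forall>\<^sub>F n in sequentially. R_star M k d yss (ys @ zs) p n \<le> twr (k - 1) (n ^ c)"
      using Suc.IH k_formula_regroup Suc.prems unfolding xss by blast
    obtain c' where c': "\<forall>n\<ge>2. (twr (k - 1) (n ^ c) + 1) ^ Suc k \<le> twr (k - 1) (n ^ c')"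
      using twr_absorbs_power[of "k - 1" c "Suc k"] Suc.hyps by auto
    have "\<forall>\<^sub>F n in sequentially. R_star M (Suc k) d xss zs p n \<le> twr k (n ^ c')"
      using c eventually_ge_at_top[of 2]
    proof eventually_elim
      case (elim n)
      have "R_star M (Suc k) d xss zs p n \<le> 2 ^ ((R_star M k d yss (ys @ zs) p n + 1) ^ Suc k)"
        unfolding xss using Suc.hyps by (intro R_star_step[OF assms(1)] ys) simp
      also have "\<dots> \<le> 2 ^ ((twr (k - 1) (n ^ c) + 1) ^ Suc k)"
        using elim(1) by (intro power_increasing power_mono) simp_all
      also have "\<dots> \<le> 2 ^ twr (k - 1) (n ^ c')"
        using c' elim(2) by (intro power_increasing) simp_all
      also have "\<dots> = twr k (n ^ c')"
        using Suc.hyps twr_Suc[of "k - 1" "n ^ c'"] by simp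
      finally show ?case .
    qed
    then show ?case by auto
  qed
  then show ?thesis by simp
qed

end
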